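(* Let $\Phi,\Psi$ be dimension functions. Suppose there are constants $0<\lambda<1$ and $x_0>0$ such that $\Phi(x)\ge\lambda\Psi(x)$ for all $0<x\le x_0$. Let $E$ be a subset of a bounded metric space. Then for any Borel probability measure $\mu$ on $E$: (1) $\overline{\dim}_\Psi\mu\ge\lambda\,\overline{\dim}_\Phi\mu$ and $\underline{\dim}_\Psi\mu\le\underline{\dim}_\Phi\mu+(1-\lambda)\dim_A\mu$; (2) $\overline{\dim}_\Psi E\ge\lambda\,\overline{\dim}_\Phi E$ and $\underline{\dim}_\Psi E\le\underline{\dim}_\Phi E+(1-\lambda)\dim_A E$.
   Context: A dimension function is a map $\Phi:(0,1)\to[0,\infty)$ such that $x^{1+\Phi(x)}$ decreases to $0$ as $x$ decreases to $0$. $B(x,R)$ is the open ball of centre $x$ and radius $R$; $N_r(Y)$ is the least number of balls of radius $r$ that cover $Y$. For a set $E$, $\overline{\dim}_\Phi E$ is the infimum of all $\alpha$ for which there exist $C_1,C_2>0$ such that for all $0<r\le R^{1+\Phi(R)}\le R<C_1$ and all $z\in E$, $N_r(B(z,R)\cap E)\le C_2(R/r)^\alpha$; $\underline{\dim}_\Phi E$ is the supremum of all $\alpha$ for which there exist $C_1,C_2>0$ such that for the same $r,R,z$, $N_r(B(z,R)\cap E)\ge C_2(R/r)^\alpha$. For a measure $\mu$, $\overline{\dim}_\Phi\mu$ is the infimum of all $\alpha$ for which there exist $C_1,C_2>0$ such that for all $0<r<R^{1+\Phi(R)}\le R\le C_1$ and all $x\in\mathrm{supp}\,\mu$, $\mu(B(x,R))/\mu(B(x,r))\le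 C_2(R/r)^\alpha$; $\underline{\dim}_\Phi\mu$ is the supremum of all $\alpha$ for which there exist $C_1,C_2>0$ such that for the same $r,R,x$, $\mu(B(x,R))/\mu(B(x,r))\ge C_2(R/r)^\alpha$. Values in $[0,\infty]$ are allowed. $\dim_A\mu$ and $\dim_A E$ are the upper $\Phi$-dimensions of $\mu$ and $E$ for $\Phi=0$. *)

theory Defs
  imports "HOL-Probability.Probability"
begin

(* Functions on (0,1) are total functions on the reals; values outside (0,1) are irrelevant
   (the definitions below evaluate Phi only at 0 < R < 1). *)
definition dimension_function :: "(real \<Rightarrow> real) \<Rightarrow> bool" where
  "dimension_function \<Phi> \<longleftrightarrow>
     (\<forall>x\<in>{0<..<1}. 0 \<le> \<Phi> x) \<and>
     mono_on {0<..<1} (\<lambda>x. x powr (1 + \<Phi> x)) \<and>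
     ((\<lambda>x. x powr (1 + \<Phi> x)) \<longlongrightarrow> 0) (at_right 0)"

(* The ambient metric space is a subset X of a metric_space type, so covering balls have centres
   in X. The value is \<infinity> if no finite cover exists. *)
definition covering_number :: "'a::metric_space set \<Rightarrow> real \<Rightarrow> 'a set \<Rightarrow> enat" where
  "covering_number X r Y =
     (INF C \<in> {C. finite C \<and> C \<subseteq> X \<and> Y \<subseteq> (\<Union>c\<in>C. ball c r)}. enat (card C))"

(* Dimensions take values in [0,\<infinity>], so exponents range over \<alpha> \<ge> 0;
   Inf {} = \<infinity> in ennreal. *)
definition upper_Phi_dim_set :: "'a::metric_space set \<Rightarrow> (real \<Rightarrow> real) \<Rightarrow> 'a set \<Rightarrow> ennreal" where
  "upper_Phi_dim_set X \<Phi> E = Inf {ennreal \<alpha> | \<alpha>. 0 \<le> \<alpha> \<and>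
     (\<exists>C1>0. \<exists>C2>0. \<forall>r R. \<forall>z\<in>E.
        0 < r \<and> r \<le> R powr (1 + \<Phi> R) \<and> R powr (1 + \<Phi> R) \<le> R \<and> R < C1 \<and> R < 1 \<longrightarrow>
        ennreal_of_enat (covering_number X r (ball z R \<inter> E)) \<le> ennreal (C2 * (R / r) powr \<alpha>))}"

definition lower_Phi_dim_set :: "'a::metric_space set \<Rightarrow> (real \<Rightarrow> real) \<Rightarrow> 'a set \<Rightarrow> ennreal" where
  "lower_Phi_dim_set X \<Phi> E = Sup {ennreal \<alpha> | \<alpha>. 0 \<le> \<alpha> \<and>
     (\<exists>C1>0. \<exists>C2>0. \<forall>r R. \<forall>z\<in>E.
        0 < r \<and> r \<le> R powr (1 + \<Phi> R) \<and> R powr (1 + \<Phi> R) \<le> R \<and> R < C1 \<and> R < 1 \<longrightarrow>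
        ennreal_of_enat (covering_number X r (ball z R \<inter> E)) \<ge> ennreal (C2 * (R / r) powr \<alpha>))}"

definition Assouad_dim_set :: "'a::metric_space set \<Rightarrow> 'a set \<Rightarrow> ennreal" where
  "Assouad_dim_set X E = upper_Phi_dim_set X (\<lambda>_. 0) E"

definition borel_prob_on :: "'a::topological_space set \<Rightarrow> 'a measure \<Rightarrow> bool" where
  "borel_prob_on E M \<longleftrightarrow> prob_space M \<and> space M = E \<and> sets M = sets (restrict_space borel E)"

(* Topological support relative to space M, which carries the subspace topology. *)
definition measure_support :: "'a::topological_space measure \<Rightarrow> 'a set" where
  "measure_support M =
     {x \<in> space M. \<forall>U. open U \<and> x \<in> U \<longrightarrow> 0 < emeasure M (U \<inter> space M)}"

(* The measure lives on space M, so balls are intersected with it. For x in the support and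
   r > 0 the denominators are positive. *)
definition upper_Phi_dim_measure :: "(real \<Rightarrow> real) \<Rightarrow> 'a::metric_space measure \<Rightarrow> ennreal" where
  "upper_Phi_dim_measure \<Phi> M = Inf {ennreal \<alpha> | \<alpha>. 0 \<le> \<alpha> \<and>
     (\<exists>C1>0. \<exists>C2>0. \<forall>r R. \<forall>x\<in>measure_support M.
        0 < r \<and> r < R powr (1 + \<Phi> R) \<and> R powr (1 + \<Phi> R) \<le> R \<and> R \<le> C1 \<and> R < 1 \<longrightarrow>
        measure M (ball x R \<inter> space M) / measure M (ball x r \<inter> space M) \<le> C2 * (R / r) powr \<alpha>)}"

definition lower_Phi_dim_measure :: "(real \<Rightarrow> real) \<Rightarrow> 'a::metric_space measure \<Rightarrow> ennreal" where
  "lower_Phi_dim_measure \<Phi> M = Sup {ennreal \<alpha> | \<alpha>. 0 \<le> \<alpha> \<and>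
     (\<exists>C1>0. \<exists>C2>0. \<forall>r R. \<forall>x\<in>measure_support M.
        0 < r \<and> r < R powr (1 + \<Phi> R) \<and> R powr (1 + \<Phi> R) \<le> R \<and> R \<le> C1 \<and> R < 1 \<longrightarrow>
        measure M (ball x R \<inter> space M) / measure M (ball x r \<inter> space M) \<ge> C2 * (R / r) powr \<alpha>)}"

definition Assouad_dim_measure :: "'a::metric_space measure \<Rightarrow> ennreal" where
  "Assouad_dim_measure M = upper_Phi_dim_measure (\<lambda>_. 0) M"

end

theory Submission
  imports Defs
begin

text \<open>
  Fix \<open>R\<close>, put \<open>s = R powr (1 + \<Psi> R)\<close> and let \<open>Q(R,r)\<close> be the quantity
  that the dimensions compare with \<open>R / r\<close>: the ratio of the masses of two concentric balls, or a
  covering number of a ball. The hypothesis \<open>lam * \<Psi> R \<le> \<Phi> R\<close> says that every radius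
  \<open>r\<close> admitted by \<open>\<Phi>\<close> is at most \<open>R powr (1 + lam * \<Psi> R)\<close>.
  Radii below \<open>s\<close> are admitted by \<open>\<Psi>\<close> as well, so only the window
  from \<open>s\<close> to \<open>R powr (1 + lam * \<Psi> R)\<close> matters, and there
  \<open>R / s \<le> (R / r) powr (1 / lam)\<close>: on a logarithmic scale the two scales differ by a factor of at
  most \<open>1 / lam\<close>.

  For the upper dimensions, \<open>Q\<close> grows when \<open>r\<close> shrinks. An exponent \<open>\<alpha>\<close> for \<open>\<Psi>\<close> thus bounds
  \<open>Q(R,r)\<close> by \<open>Q(R,s)\<close>, hence by a multiple of
  \<open>(R / s) powr \<alpha> \<le> (R / r) powr (\<alpha> / lam)\<close>, and
  \<open>\<alpha> / lam\<close> is an exponent for \<open>\<Phi>\<close>.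

  For the lower dimensions, \<open>Q(R,s) \<le> Q(R,r) * Q(r,s)\<close>: mass ratios are multiplicative, and covering
  numbers are submultiplicative once \<open>Q(r,s)\<close> is read as the largest one of a ball of radius \<open>2 * r\<close>
  around a point of \<open>E\<close> (lemma \<open>covering_number_submult\<close>). The left-hand side is at least a
  multiple of \<open>(R / s) powr \<alpha>\<close>, and an Assouad exponent \<open>d\<close> bounds \<open>Q(r,s)\<close> by a multiple of
  \<open>(r / s) powr d\<close>. Lemma \<open>powr_window_split\<close> compares these powers, so that
  \<open>\<alpha> - (1 - lam) * d\<close> is a lower exponent for \<open>\<Phi>\<close> unless it is negative.

  The bounds pass to the dimensions by taking infima and suprema over \<open>\<alpha>\<close> and \<open>d\<close>.
\<close>

section \<open>Power estimates in the window of radii\<close>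

text \<open>
  In terms of \<open>ln (R / r)\<close>, the bound on \<open>r\<close> reads
  \<open>lam * ln (R / s) \<le> ln (R / r)\<close> for \<open>s = R powr (1 + p)\<close>.
\<close>

lemma powr_window_root:
  fixes R r p lam \<alpha> :: real
  assumes "0 < R" "0 < r" "r \<le> R powr (1 + lam * p)" "0 < lam" "0 \<le> \<alpha>"
  shows "(R / R powr (1 + p)) powr \<alpha> \<le> (R / r) powr (\<alpha> / lam)"
proof -
  have "ln r \<le> (1 + lam * p) * ln R"
    using assms ln_mono[OF assms(3,2)] by (simp add: ln_powr)
  then have "lam * (- p * ln R) \<le> ln R - ln r"
    by (simp add: algebra_simps)
  then have "- p * ln R \<le> (ln R - ln r) / lam"
    using assms by (simp add: field_simps)
  then have "\<alpha> * (- p * ln R) \<le> \<alpha> * ((ln R - ln r) / lam)"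
    using assms(5) by (rule mult_left_mono)
  then show ?thesis
    using assms by (simp add: powr_def ln_div algebra_simps diff_divide_distrib)
qed

text \<open>
  With \<open>x = ln (R / s)\<close> and \<open>y = ln (R / r)\<close>, where \<open>s = R powr (1 + p)\<close>, the window is
  \<open>lam * x \<le> y \<le> x\<close>, and the inequality follows from
  \<open>(\<beta> + (1 - lam) * d) * x = \<beta> * y + d * (x - y) + \<beta> * (x - y) + d * (y - lam * x)\<close>.
\<close>

lemma powr_window_split:
  fixes R r p lam \<beta> d :: real
  assumes "0 < R" "R powr (1 + p) \<le> r" "r \<le> R powr (1 + lam * p)" "0 \<le> \<beta>" "0 \<le> d"
  shows "(R / r) powr \<beta> * (r / R powr (1 + p)) powr d
           \<le> (R / R powr (1 + p)) powr (\<beta> + (1 - lam) * d)"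
proof -
  define x where "x = - p * ln R"
  define y where "y = ln R - ln r"
  have r: "0 < r"
    using assms(1,2) by (smt (verit) powr_gt_zero)
  have "ln r \<le> (1 + lam * p) * ln R"
    using assms ln_mono[OF assms(3) r] by (simp add: ln_powr)
  then have 1: "lam * x \<le> y"
    by (simp add: x_def y_def algebra_simps)
  have "(1 + p) * ln R \<le> ln r"
    using assms ln_mono[OF assms(2)] by (simp add: ln_powr)
  then have 2: "y \<le> x"
    by (simp add: x_def y_def algebra_simps)
  have "0 \<le> \<beta> * (x - y)" "0 \<le> d * (y - lam * x)"
    using 1 2 assms by simp_all
  then have "\<beta> * y + d * (x - y) \<le> (\<beta> + (1 - lam) * d) * x"
    by (simp add: algebra_simps)
  moreover have "(R / r) powr \<beta> * (r / R powr (1 + p)) powr d = exp (\<beta> * y + d * (x - y))"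
    using assms(1) r by (simp add: powr_def ln_div x_def y_def algebra_simps flip: exp_add)
  moreover have "(R / R powr (1 + p)) powr (\<beta> + (1 - lam) * d) = exp ((\<beta> + (1 - lam) * d) * x)"
    using assms(1) by (simp add: powr_def ln_div x_def algebra_simps)
  ultimately show ?thesis
    by simp
qed

section \<open>From exponents to dimensions\<close>

lemma mult_Inf_exponents_le:
  fixes lam :: real
  assumes "0 < lam" and "\<And>\<alpha>. 0 \<le> \<alpha> \<Longrightarrow> P \<alpha> \<Longrightarrow> Q (\<alpha> / lam)"
  shows "ennreal lam * Inf {ennreal \<alpha> | \<alpha>. 0 \<le> \<alpha> \<and> Q \<alpha>} \<le> Inf {ennreal \<alpha> | \<alpha>. 0 \<le> \<alpha> \<and> P \<alpha>}"
proof (rule Inf_greatest, clarify)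
  fix \<alpha> :: real
  assume \<alpha>: "0 \<le> \<alpha>" "P \<alpha>"
  have "Inf {ennreal \<alpha> | \<alpha>. 0 \<le> \<alpha> \<and> Q \<alpha>} \<le> ennreal (\<alpha> / lam)"
    using assms \<alpha> by (intro Inf_lower CollectI exI[of _ "\<alpha> / lam"]) auto
  then have "ennreal lam * Inf {ennreal \<alpha> | \<alpha>. 0 \<le> \<alpha> \<and> Q \<alpha>} \<le> ennreal lam * ennreal (\<alpha> / lam)"
    by (rule mult_left_mono) simp
  also have "\<dots> = ennreal \<alpha>"
    using assms(1) \<alpha> by (simp flip: ennreal_mult)
  finally show "ennreal lam * Inf {ennreal \<alpha> | \<alpha>. 0 \<le> \<alpha> \<and> Q \<alpha>} \<le> ennreal \<alpha>" .
qed

text \<open>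
  If some \<open>\<alpha> - c * d\<close> is negative, then \<open>\<alpha> \<le> c * d\<close> already; this is why \<open>Q\<close> is asked for
  nonnegative exponents only.
\<close>

lemma Sup_exponents_le_add_mult_Inf:
  fixes c :: real
  assumes "0 < c"
    and step: "\<And>\<beta> d. 0 \<le> \<beta> \<Longrightarrow> 0 \<le> d \<Longrightarrow> P (\<beta> + c * d) \<Longrightarrow> A d \<Longrightarrow> Q \<beta>"
  shows "Sup {ennreal \<alpha> | \<alpha>. 0 \<le> \<alpha> \<and> P \<alpha>}
           \<le> Sup {ennreal \<alpha> | \<alpha>. 0 \<le> \<alpha> \<and> Q \<alpha>} + ennreal c * Inf {ennreal \<alpha> | \<alpha>. 0 \<le> \<alpha> \<and> A \<alpha>}"
    (is "_ \<le> ?L + _ * Inf ?A")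
proof (rule Sup_least, clarify)
  fix \<alpha> :: real
  assume \<alpha>: "0 \<le> \<alpha>" "P \<alpha>"
  have bound: "ennreal \<alpha> \<le> ?L + ennreal c * ennreal d" if d: "0 \<le> d" "A d" for d
  proof (cases "\<alpha> \<le> c * d")
    case True
    then have "ennreal \<alpha> \<le> ennreal c * ennreal d"
      using assms(1) d by (simp add: ennreal_leI flip: ennreal_mult)
    then show ?thesis
      by (meson add_increasing zero_le)
  next
    case False
    define \<beta> where "\<beta> = \<alpha> - c * d"
    have "0 \<le> \<beta>" "Q \<beta>"
      using False step[of \<beta> d] d \<alpha> by (auto simp: \<beta>_def)
    then have "ennreal \<beta> \<le> ?L"
      by (intro Sup_upper) auto
    then have "ennreal \<beta> + ennreal c * ennreal d \<le> ?L + ennreal c * ennreal d"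
      by (rule add_right_mono)
    moreover have "ennreal \<beta> + ennreal c * ennreal d = ennreal \<alpha>"
      using \<open>0 \<le> \<beta>\<close> assms(1) d by (simp add: \<beta>_def flip: ennreal_mult ennreal_plus)
    ultimately show ?thesis by simp
  qed
  have "(ennreal \<alpha> - ?L) / ennreal c \<le> Inf ?A"
  proof (rule Inf_greatest, clarify)
    fix d :: real
    assume "0 \<le> d" "A d"
    then have "ennreal \<alpha> - ?L \<le> ennreal c * ennreal d"
      using bound ennreal_minus_le_iff by auto
    then show "(ennreal \<alpha> - ?L) / ennreal c \<le> ennreal d"
      using assms(1) by (simp add: divide_le_posI_ennreal)
  qed
  then have "ennreal c * ((ennreal \<alpha> - ?L) / ennreal c) \<le> ennreal c * Inf ?A"
    by (rule mult_left_mono) simp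
  moreover have "ennreal c * ((ennreal \<alpha> - ?L) / ennreal c) = ennreal \<alpha> - ?L"
    using assms(1)
    by (simp add: ennreal_times_divide mult.commute[of "ennreal c"] mult_divide_eq_ennreal)
  ultimately have "ennreal \<alpha> - ?L \<le> ennreal c * Inf ?A" by simp
  then show "ennreal \<alpha> \<le> ?L + ennreal c * Inf ?A"
    by (simp add: ennreal_minus_le_iff)
qed

section \<open>Measures\<close>

definition upper_exponent_measure :: "(real \<Rightarrow> real) \<Rightarrow> 'a::metric_space measure \<Rightarrow> real \<Rightarrow> bool" where
  "upper_exponent_measure \<Phi> M \<alpha> \<longleftrightarrow>
     (\<exists>C1>0. \<exists>C2>0. \<forall>r R. \<forall>x\<in>measure_support M.
        0 < r \<and> r < R powr (1 + \<Phi> R) \<and> R powr (1 + \<Phi> R) \<le> R \<and> R \<le> C1 \<and> R < 1 \<longrightarrow>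
        measure M (ball x R \<inter> space M) / measure M (ball x r \<inter> space M) \<le> C2 * (R / r) powr \<alpha>)"

definition lower_exponent_measure :: "(real \<Rightarrow> real) \<Rightarrow> 'a::metric_space measure \<Rightarrow> real \<Rightarrow> bool" where
  "lower_exponent_measure \<Phi> M \<alpha> \<longleftrightarrow>
     (\<exists>C1>0. \<exists>C2>0. \<forall>r R. \<forall>x\<in>measure_support M.
        0 < r \<and> r < R powr (1 + \<Phi> R) \<and> R powr (1 + \<Phi> R) \<le> R \<and> R \<le> C1 \<and> R < 1 \<longrightarrow>
        measure M (ball x R \<inter> space M) / measure M (ball x r \<inter> space M) \<ge> C2 * (R / r) powr \<alpha>)"

lemma measure_ball_support_pos:
  assumes "borel_prob_on E M" "x \<in> measure_support M" "0 < r"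
  shows "0 < measure M (ball x r \<inter> space M)"
proof -
  interpret prob_space M
    using assms by (simp add: borel_prob_on_def)
  have "0 < emeasure M (ball x r \<inter> space M)"
    using assms by (simp add: measure_support_def)
  then show ?thesis
    by (simp add: emeasure_eq_measure)
qed

lemma measure_ball_mono:
  assumes "borel_prob_on E M" "r \<le> r'"
  shows "measure M (ball x r \<inter> space M) \<le> measure M (ball x r' \<inter> space M)"
proof -
  interpret prob_space M
    using assms by (simp add: borel_prob_on_def)
  have "space M = E" "sets M = (\<inter>) E ` sets borel"
    using assms(1) by (simp_all add: borel_prob_on_def sets_restrict_space)
  then have "ball x r' \<inter> space M \<in> sets M"
    by (auto simp: Int_commute)
  then show ?thesis
    using assms(2) by (intro finite_measure_mono) auto
qed

lemma powr_one_plus_le_self: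
  fixes R p :: real
  assumes "0 < R" "R < 1" "0 \<le> p"
  shows "R powr (1 + p) \<le> R"
  using powr_mono'[of 1 "1 + p" R] assms by simp

text \<open>
  The window contains radii \<open>r \<ge> s = R powr (1 + \<Psi> R)\<close>, but for measures \<open>\<Psi>\<close> admits
  only radii strictly below \<open>s\<close>. So \<open>s / 2\<close> stands in for \<open>s\<close>, at the price of a factor
  \<open>2 powr \<alpha>\<close> in the constant.
\<close>

lemma upper_exponent_measure_transfer:
  fixes lam :: real
  assumes M: "borel_prob_on E M"
    and \<Psi>: "\<And>x. 0 < x \<Longrightarrow> x < 1 \<Longrightarrow> 0 \<le> \<Psi> x"
    and lam: "0 < lam" "lam < 1" "0 < x0"
    and le: "\<And>x. 0 < x \<Longrightarrow> x \<le> x0 \<Longrightarrow> x < 1 \<Longrightarrow> lam * \<Psi> x \<le> \<Phi> x"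
    and \<alpha>: "0 \<le> \<alpha>" "upper_exponent_measure \<Psi> M \<alpha>"
  shows "upper_exponent_measure \<Phi> M (\<alpha> / lam)"
proof -
  obtain C1 C2 where C: "0 < C1" "0 < C2"
    and bound: "\<And>r R x. x \<in> measure_support M \<Longrightarrow> 0 < r \<Longrightarrow> r < R powr (1 + \<Psi> R) \<Longrightarrow>
        R powr (1 + \<Psi> R) \<le> R \<Longrightarrow> R \<le> C1 \<Longrightarrow> R < 1 \<Longrightarrow>
        measure M (ball x R \<inter> space M) / measure M (ball x r \<inter> space M) \<le> C2 * (R / r) powr \<alpha>"
    using \<alpha>(2) unfolding upper_exponent_measure_def
    by (elim exE conjE) (rule that; blast)
  have "measure M (ball x R \<inter> space M) / measure M (ball x r \<inter> space M)
          \<le> (C2 * 2 powr \<alpha>) * (R / r) powr (\<alpha> / lam)"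
    if x: "x \<in> measure_support M" and r: "0 < r" "r < R powr (1 + \<Phi> R)"
      and R: "R powr (1 + \<Phi> R) \<le> R" "R \<le> min C1 x0" "R < 1" for x r R
  proof -
    define s where "s = R powr (1 + \<Psi> R)"
    have R0: "0 < R" using r R by linarith
    have s: "0 < s" "s \<le> R"
      using R0 R powr_one_plus_le_self[of R "\<Psi> R"] \<Psi> by (auto simp: s_def)
    have "R powr (1 + \<Phi> R) \<le> R powr (1 + lam * \<Psi> R)"
      using R R0 le[of R] by (intro powr_mono') auto
    then have r_le: "r \<le> R powr (1 + lam * \<Psi> R)" using r by linarith
    define t where "t = min r (s / 2)"
    have t: "0 < t" "t < s" "t \<le> r" using r s by (auto simp: t_def)
    have "measure M (ball x R \<inter> space M) / measure M (ball x r \<inter> space M)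
            \<le> measure M (ball x R \<inter> space M) / measure M (ball x t \<inter> space M)"
      using measure_ball_support_pos[OF M x t(1)] measure_ball_mono[OF M t(3)]
      by (intro divide_left_mono mult_pos_pos) (auto intro: less_le_trans)
    also have "\<dots> \<le> C2 * (R / t) powr \<alpha>"
      using bound[OF x t(1)] t s R by (simp add: s_def)
    also have "\<dots> \<le> C2 * (2 powr \<alpha> * (R / r) powr (\<alpha> / lam))"
    proof (intro mult_left_mono)
      have "R powr (1 + \<Phi> R) \<le> R" by fact
      then have "1 \<le> R / r" using r by simp
      then have "(R / r) powr \<alpha> \<le> (R / r) powr (\<alpha> / lam)"
        using lam \<alpha> by (intro powr_mono) (auto simp: field_simps mult_left_le)
      also have "\<dots> \<le> 2 powr \<alpha> * (R / r) powr (\<alpha> / lam)"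
        using ge_one_powr_ge_zero[of 2 \<alpha>] \<alpha> by (simp add: mult_le_cancel_right1)
      finally have 1: "(R / r) powr \<alpha> \<le> 2 powr \<alpha> * (R / r) powr (\<alpha> / lam)" .
      have "(R / (s / 2)) powr \<alpha> = 2 powr \<alpha> * (R / s) powr \<alpha>"
        using powr_mult[of 2 "R / s" \<alpha>] by (simp add: mult.commute)
      also have "\<dots> \<le> 2 powr \<alpha> * (R / r) powr (\<alpha> / lam)"
        using powr_window_root[OF R0 r(1) r_le lam(1) \<alpha>(1)] by (simp add: s_def)
      finally show "(R / t) powr \<alpha> \<le> 2 powr \<alpha> * (R / r) powr (\<alpha> / lam)"
        using 1 by (simp add: t_def min_def)
    qed (use C in simp)
    finally show ?thesis by (simp add: mult.assoc)
  qed
  then show ?thesis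
    unfolding upper_exponent_measure_def using C lam
    by (intro exI[of _ "min C1 x0"] conjI exI[of _ "C2 * 2 powr \<alpha>"]) auto
qed

text \<open>
  If \<open>r\<close> lies in the window, then with \<open>t = s / 2\<close> as before, the ratio at \<open>(R, t)\<close> is the product of the ratios at
  \<open>(R, r)\<close> and \<open>(r, t)\<close>.
\<close>

lemma lower_exponent_measure_transfer:
  fixes lam :: real
  assumes M: "borel_prob_on E M"
    and \<Psi>: "\<And>x. 0 < x \<Longrightarrow> x < 1 \<Longrightarrow> 0 \<le> \<Psi> x"
    and lam: "lam < 1" "0 < x0"
    and le: "\<And>x. 0 < x \<Longrightarrow> x \<le> x0 \<Longrightarrow> x < 1 \<Longrightarrow> lam * \<Psi> x \<le> \<Phi> x"
    and \<beta>: "0 \<le> \<beta>" and d: "0 \<le> d"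
    and \<alpha>: "lower_exponent_measure \<Psi> M (\<beta> + (1 - lam) * d)"
    and A: "upper_exponent_measure (\<lambda>_. 0) M d"
  shows "lower_exponent_measure \<Phi> M \<beta>"
proof -
  define \<alpha> where "\<alpha> = \<beta> + (1 - lam) * d"
  have \<alpha>0: "\<beta> \<le> \<alpha>" using lam d by (simp add: \<alpha>_def)
  obtain C1 C2 where C: "0 < C1" "0 < C2"
    and bound: "\<And>r R x. x \<in> measure_support M \<Longrightarrow> 0 < r \<Longrightarrow> r < R powr (1 + \<Psi> R) \<Longrightarrow>
        R powr (1 + \<Psi> R) \<le> R \<Longrightarrow> R \<le> C1 \<Longrightarrow> R < 1 \<Longrightarrow>
        C2 * (R / r) powr \<alpha> \<le> measure M (ball x R \<inter> space M) / measure M (ball x r \<inter> space M)"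
    using \<alpha>[folded \<alpha>_def] unfolding lower_exponent_measure_def
    by (elim exE conjE) (rule that; blast)
  obtain D1 D2 where D: "0 < D1" "0 < D2"
    and "\<And>r R x. x \<in> measure_support M \<Longrightarrow> 0 < r \<Longrightarrow> r < R powr (1 + 0) \<Longrightarrow>
        R powr (1 + 0) \<le> R \<Longrightarrow> R \<le> D1 \<Longrightarrow> R < 1 \<Longrightarrow>
        measure M (ball x R \<inter> space M) / measure M (ball x r \<inter> space M) \<le> D2 * (R / r) powr d"
    using A unfolding upper_exponent_measure_def
    by (elim exE conjE) (rule that; blast)
  then have boundA: "\<And>r R x. x \<in> measure_support M \<Longrightarrow> 0 < r \<Longrightarrow> r < R \<Longrightarrow> R \<le> D1 \<Longrightarrow> R < 1 \<Longrightarrow>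
        measure M (ball x R \<inter> space M) / measure M (ball x r \<inter> space M) \<le> D2 * (R / r) powr d"
    by simp
  define K where "K = min C2 (C2 / (D2 * 2 powr d))"
  have K: "0 < K" using C D by (simp add: K_def)
  have "K * (R / r) powr \<beta> \<le> measure M (ball x R \<inter> space M) / measure M (ball x r \<inter> space M)"
    if x: "x \<in> measure_support M" and r: "0 < r" "r < R powr (1 + \<Phi> R)"
      and R: "R powr (1 + \<Phi> R) \<le> R" "R \<le> Min {C1, D1, x0}" "R < 1" for x r R
  proof -
    define s where "s = R powr (1 + \<Psi> R)"
    have R0: "0 < R" and rR: "r < R" using r R by linarith+
    have s: "0 < s" "s \<le> R"
      using R0 R powr_one_plus_le_self[of R "\<Psi> R"] \<Psi> by (auto simp: s_def)
    show ?thesis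
    proof (cases "r < s")
      case True
      have "K * (R / r) powr \<beta> \<le> C2 * (R / r) powr \<alpha>"
        using \<alpha>0 C rR r by (intro mult_mono powr_mono) (auto simp: K_def)
      also have "\<dots> \<le> measure M (ball x R \<inter> space M) / measure M (ball x r \<inter> space M)"
        using bound[OF x r(1)] True s R by (simp add: s_def)
      finally show ?thesis .
    next
      case False
      define t where "t = s / 2"
      have t: "0 < t" "t < s" "t < r" using False s by (auto simp: t_def)
      have "R powr (1 + \<Phi> R) \<le> R powr (1 + lam * \<Psi> R)"
        using R R0 le[of R] by (intro powr_mono') auto
      then have r_le: "r \<le> R powr (1 + lam * \<Psi> R)" using r by linarith
      let ?Q = "\<lambda>R r. measure M (ball x R \<inter> space M) / measure M (ball x r \<inter> space M)"
      have "C2 * ((R / r) powr \<beta> * (r / s) powr d) \<le> C2 * (R / s) powr \<alpha>"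
        using powr_window_split[OF R0 _ r_le \<beta> d] False C by (simp add: s_def \<alpha>_def)
      also have "\<dots> \<le> C2 * (R / t) powr \<alpha>"
        using C \<alpha>0 \<beta> R0 s t by (intro mult_left_mono powr_mono2 divide_left_mono) auto
      also have "\<dots> \<le> ?Q R t"
        using bound[OF x t(1)] t s R by (simp add: s_def)
      also have "\<dots> = ?Q R r * ?Q r t"
        using measure_ball_support_pos[OF M x r(1)] by simp
      also have "\<dots> \<le> ?Q R r * (D2 * (r / t) powr d)"
        using boundA[OF x t(1) t(3)] rR R by (intro mult_left_mono) auto
      also have "(r / t) powr d = 2 powr d * (r / s) powr d"
        using powr_mult[of 2 "r / s" d] by (simp add: t_def mult.commute)
      finally have "C2 * (R / r) powr \<beta> * (r / s) powr d \<le> ?Q R r * (D2 * 2 powr d) * (r / s) powr d"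
        by (simp only: mult.assoc)
      then have "C2 * (R / r) powr \<beta> \<le> ?Q R r * (D2 * 2 powr d)"
        using r s by (subst (asm) mult_le_cancel_right_pos) auto
      then have "C2 / (D2 * 2 powr d) * (R / r) powr \<beta> \<le> ?Q R r"
        using D by (simp add: pos_divide_le_eq)
      moreover have "K * (R / r) powr \<beta> \<le> C2 / (D2 * 2 powr d) * (R / r) powr \<beta>"
        by (intro mult_right_mono) (auto simp: K_def)
      ultimately show ?thesis by linarith
    qed
  qed
  then show ?thesis
    unfolding lower_exponent_measure_def using C D lam K
    by (intro exI[of _ "Min {C1, D1, x0}"] conjI exI[of _ K]) auto
qed

section \<open>Sets\<close>

definition upper_exponent_set :: "'a::metric_space set \<Rightarrow> (real \<Rightarrow> real) \<Rightarrow> 'a set \<Rightarrow> real \<Rightarrow> bool" where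
  "upper_exponent_set X \<Phi> E \<alpha> \<longleftrightarrow>
     (\<exists>C1>0. \<exists>C2>0. \<forall>r R. \<forall>z\<in>E.
        0 < r \<and> r \<le> R powr (1 + \<Phi> R) \<and> R powr (1 + \<Phi> R) \<le> R \<and> R < C1 \<and> R < 1 \<longrightarrow>
        ennreal_of_enat (covering_number X r (ball z R \<inter> E)) \<le> ennreal (C2 * (R / r) powr \<alpha>))"

definition lower_exponent_set :: "'a::metric_space set \<Rightarrow> (real \<Rightarrow> real) \<Rightarrow> 'a set \<Rightarrow> real \<Rightarrow> bool" where
  "lower_exponent_set X \<Phi> E \<alpha> \<longleftrightarrow>
     (\<exists>C1>0. \<exists>C2>0. \<forall>r R. \<forall>z\<in>E.
        0 < r \<and> r \<le> R powr (1 + \<Phi> R) \<and> R powr (1 + \<Phi> R) \<le> R \<and> R < C1 \<and> R < 1 \<longrightarrow>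
        ennreal_of_enat (covering_number X r (ball z R \<inter> E)) \<ge> ennreal (C2 * (R / r) powr \<alpha>))"

lemma covering_number_le_card:
  assumes "finite C" "C \<subseteq> X" "Y \<subseteq> (\<Union>c\<in>C. ball c r)"
  shows "covering_number X r Y \<le> enat (card C)"
  unfolding covering_number_def using assms by (intro INF_lower) auto

lemma covering_number_attained:
  assumes "covering_number X r Y = enat n"
  obtains C where "finite C" "C \<subseteq> X" "Y \<subseteq> (\<Union>c\<in>C. ball c r)" "card C = n"
proof -
  let ?S = "{C. finite C \<and> C \<subseteq> X \<and> Y \<subseteq> (\<Union>c\<in>C. ball c r)}"
  have "?S \<noteq> {}"
  proof
    assume "?S = {}"
    then have "covering_number X r Y = top"
      by (simp only: covering_number_def image_empty Inf_empty)
    with assms show False by (simp add: top_enat_def)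
  qed
  then obtain C0 where "C0 \<in> ?S"
    by blast
  then have "covering_number X r Y \<in> (\<lambda>C. enat (card C)) ` ?S"
    unfolding covering_number_def by (intro wellorder_InfI[OF imageI])
  then obtain C where "C \<in> ?S" "covering_number X r Y = enat (card C)"
    by (rule imageE)
  then show ?thesis
    using assms by (intro that[of C]) simp_all
qed

lemma covering_number_antimono_radius:
  assumes "r \<le> r'"
  shows "covering_number X r' Y \<le> covering_number X r Y"
proof -
  have cover: "Y \<subseteq> (\<Union>c\<in>C. ball c r')" if "Y \<subseteq> (\<Union>c\<in>C. ball c r)" for C
    using that by (rule order_trans) (intro UN_mono subset_ball assms order_refl)
  show ?thesis
    unfolding covering_number_def
  proof (rule INF_superset_mono)
    show "{C. finite C \<and> C \<subseteq> X \<and> Y \<subseteq> (\<Union>c\<in>C. ball c r)}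
            \<subseteq> {C. finite C \<and> C \<subseteq> X \<and> Y \<subseteq> (\<Union>c\<in>C. ball c r')}"
      by (intro Collect_mono impI conjI; elim conjE) (assumption | rule cover)+
  qed (rule order_refl)
qed

text \<open>
  Each ball of an optimal cover of \<open>Y\<close> is covered in turn. Its centre need not lie in \<open>E\<close>, so a ball
  of radius \<open>r\<close> that meets \<open>E\<close> is enclosed in a ball of radius \<open>2 * r\<close> around a point of \<open>E\<close>.
\<close>

lemma covering_number_submult:
  fixes B :: real
  assumes B: "0 \<le> B"
    and local_bound: "\<And>w. w \<in> E \<Longrightarrow> ennreal_of_enat (covering_number X s (ball w (2 * r) \<inter> E)) \<le> ennreal B"
    and "Y \<subseteq> E" and n: "covering_number X r Y = enat n"
  shows "ennreal_of_enat (covering_number X s Y) \<le> ennreal (real n * B)"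
proof -
  obtain C where C: "finite C" "C \<subseteq> X" "Y \<subseteq> (\<Union>c\<in>C. ball c r)" "card C = n"
    using covering_number_attained[OF n] .
  have "\<exists>D. finite D \<and> D \<subseteq> X \<and> ball c r \<inter> E \<subseteq> (\<Union>e\<in>D. ball e s) \<and> real (card D) \<le> B" for c
  proof (cases "ball c r \<inter> E = {}")
    case True
    then show ?thesis
      using B by (intro exI[of _ "{}"]) auto
  next
    case False
    then obtain w where w: "w \<in> E" "dist c w < r" by auto
    have sub: "ball c r \<inter> E \<subseteq> ball w (2 * r) \<inter> E"
    proof (clarsimp)
      fix v assume "dist c v < r"
      then show "dist w v < 2 * r"
        using w dist_triangle3[of w v c] by linarith
    qed
    obtain m where m: "covering_number X s (ball w (2 * r) \<inter> E) = enat m"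
      using local_bound[OF w(1)] by (cases "covering_number X s (ball w (2 * r) \<inter> E)")
        (auto simp: top_unique)
    obtain D where D: "finite D" "D \<subseteq> X" "ball w (2 * r) \<inter> E \<subseteq> (\<Union>e\<in>D. ball e s)" "card D = m"
      using covering_number_attained[OF m] .
    have "real m \<le> B"
      using local_bound[OF w(1)] B by (simp add: m ennreal_of_nat_eq_real_of_nat)
    then show ?thesis
      using D sub by (intro exI[of _ D]) auto
  qed
  then obtain D where D: "\<And>c. finite (D c)" "\<And>c. D c \<subseteq> X"
      "\<And>c. ball c r \<inter> E \<subseteq> (\<Union>e\<in>D c. ball e s)" "\<And>c. real (card (D c)) \<le> B"
    by metis
  have "Y \<subseteq> (\<Union>e\<in>(\<Union>c\<in>C. D c). ball e s)"
  proof
    fix y assume "y \<in> Y"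
    then obtain c where "c \<in> C" "y \<in> ball c r \<inter> E"
      using C(3) assms(3) by blast
    then show "y \<in> (\<Union>e\<in>(\<Union>c\<in>C. D c). ball e s)"
      using D(3)[of c] by blast
  qed
  then have "covering_number X s Y \<le> enat (card (\<Union>c\<in>C. D c))"
    using C(1) D by (intro covering_number_le_card) auto
  then have "ennreal_of_enat (covering_number X s Y) \<le> ennreal (real (card (\<Union>c\<in>C. D c)))"
    by (metis ennreal_of_enat_enat ennreal_of_enat_le_iff ennreal_of_nat_eq_real_of_nat)
  also have "real (card (\<Union>c\<in>C. D c)) \<le> (\<Sum>c\<in>C. real (card (D c)))"
    using card_UN_le[OF C(1), of D] by (metis of_nat_le_iff of_nat_sum)
  also have "\<dots> \<le> real n * B"
    using sum_bounded_above[of C "\<lambda>c. real (card (D c))" B] D(4) C(4) by simp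
  finally show ?thesis
    by (simp add: ennreal_leI)
qed

lemma upper_exponent_set_transfer:
  fixes lam :: real
  assumes \<Psi>: "\<And>x. 0 < x \<Longrightarrow> x < 1 \<Longrightarrow> 0 \<le> \<Psi> x"
    and lam: "0 < lam" "lam < 1" "0 < x0"
    and le: "\<And>x. 0 < x \<Longrightarrow> x \<le> x0 \<Longrightarrow> x < 1 \<Longrightarrow> lam * \<Psi> x \<le> \<Phi> x"
    and \<alpha>: "0 \<le> \<alpha>" "upper_exponent_set X \<Psi> E \<alpha>"
  shows "upper_exponent_set X \<Phi> E (\<alpha> / lam)"
proof -
  obtain C1 C2 where C: "0 < C1" "0 < C2"
    and bound: "\<And>r R z. z \<in> E \<Longrightarrow> 0 < r \<Longrightarrow> r \<le> R powr (1 + \<Psi> R) \<Longrightarrow>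
        R powr (1 + \<Psi> R) \<le> R \<Longrightarrow> R < C1 \<Longrightarrow> R < 1 \<Longrightarrow>
        ennreal_of_enat (covering_number X r (ball z R \<inter> E)) \<le> ennreal (C2 * (R / r) powr \<alpha>)"
    using \<alpha>(2) unfolding upper_exponent_set_def
    by (elim exE conjE) (rule that; blast)
  have "ennreal_of_enat (covering_number X r (ball z R \<inter> E)) \<le> ennreal (C2 * (R / r) powr (\<alpha> / lam))"
    if z: "z \<in> E" and r: "0 < r" "r \<le> R powr (1 + \<Phi> R)"
      and R: "R powr (1 + \<Phi> R) \<le> R" "R < min C1 x0" "R < 1" for z r R
  proof -
    define s where "s = R powr (1 + \<Psi> R)"
    have R0: "0 < R" using r R by linarith
    have s: "0 < s" "s \<le> R"
      using R0 R powr_one_plus_le_self[of R "\<Psi> R"] \<Psi> by (auto simp: s_def)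
    have "R powr (1 + \<Phi> R) \<le> R powr (1 + lam * \<Psi> R)"
      using R R0 le[of R] by (intro powr_mono') auto
    then have r_le: "r \<le> R powr (1 + lam * \<Psi> R)" using r by linarith
    define t where "t = min r s"
    have t: "0 < t" "t \<le> s" "t \<le> r" using r s by (auto simp: t_def)
    have "ennreal_of_enat (covering_number X r (ball z R \<inter> E))
            \<le> ennreal_of_enat (covering_number X t (ball z R \<inter> E))"
      using covering_number_antimono_radius[OF t(3)] by simp
    also have "\<dots> \<le> ennreal (C2 * (R / t) powr \<alpha>)"
      using bound[OF z t(1)] t s R by (simp add: s_def)
    also have "\<dots> \<le> ennreal (C2 * (R / r) powr (\<alpha> / lam))"
    proof (intro ennreal_leI mult_left_mono)
      have "1 \<le> R / r" using r R by simp
      then have "(R / r) powr \<alpha> \<le> (R / r) powr (\<alpha> / lam)"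
        using lam \<alpha> by (intro powr_mono) (auto simp: field_simps mult_left_le)
      moreover have "(R / s) powr \<alpha> \<le> (R / r) powr (\<alpha> / lam)"
        using powr_window_root[OF R0 r(1) r_le lam(1) \<alpha>(1)] by (simp add: s_def)
      ultimately show "(R / t) powr \<alpha> \<le> (R / r) powr (\<alpha> / lam)"
        by (simp add: t_def min_def)
    qed (use C in simp)
    finally show ?thesis .
  qed
  then show ?thesis
    unfolding upper_exponent_set_def using C lam
    by (intro exI[of _ "min C1 x0"] conjI exI[of _ C2]) auto
qed

text \<open>
  The Assouad bound is applied to balls of radius \<open>2 * r\<close>, see \<open>covering_number_submult\<close>. This costs the
  factor \<open>2 powr d\<close>, and \<open>R\<close> is taken below \<open>D1 / 2\<close> and \<open>1 / 2\<close> so that \<open>2 * r\<close> is small enough.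
\<close>

lemma lower_exponent_set_transfer:
  fixes lam :: real
  assumes \<Psi>: "\<And>x. 0 < x \<Longrightarrow> x < 1 \<Longrightarrow> 0 \<le> \<Psi> x"
    and lam: "lam < 1" "0 < x0"
    and le: "\<And>x. 0 < x \<Longrightarrow> x \<le> x0 \<Longrightarrow> x < 1 \<Longrightarrow> lam * \<Psi> x \<le> \<Phi> x"
    and \<beta>: "0 \<le> \<beta>" and d: "0 \<le> d"
    and \<alpha>: "lower_exponent_set X \<Psi> E (\<beta> + (1 - lam) * d)"
    and A: "upper_exponent_set X (\<lambda>_. 0) E d"
  shows "lower_exponent_set X \<Phi> E \<beta>"
proof -
  define \<alpha> where "\<alpha> = \<beta> + (1 - lam) * d"
  have \<alpha>0: "\<beta> \<le> \<alpha>" using lam d by (simp add: \<alpha>_def)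
  obtain C1 C2 where C: "0 < C1" "0 < C2"
    and bound: "\<And>r R z. z \<in> E \<Longrightarrow> 0 < r \<Longrightarrow> r \<le> R powr (1 + \<Psi> R) \<Longrightarrow>
        R powr (1 + \<Psi> R) \<le> R \<Longrightarrow> R < C1 \<Longrightarrow> R < 1 \<Longrightarrow>
        ennreal (C2 * (R / r) powr \<alpha>) \<le> ennreal_of_enat (covering_number X r (ball z R \<inter> E))"
    using \<alpha>[folded \<alpha>_def] unfolding lower_exponent_set_def
    by (elim exE conjE) (rule that; blast)
  obtain D1 D2 where D: "0 < D1" "0 < D2"
    and "\<And>r R z. z \<in> E \<Longrightarrow> 0 < r \<Longrightarrow> r \<le> R powr (1 + 0) \<Longrightarrow>
        R powr (1 + 0) \<le> R \<Longrightarrow> R < D1 \<Longrightarrow> R < 1 \<Longrightarrow>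
        ennreal_of_enat (covering_number X r (ball z R \<inter> E)) \<le> ennreal (D2 * (R / r) powr d)"
    using A unfolding upper_exponent_set_def
    by (elim exE conjE) (rule that; blast)
  then have boundA: "\<And>r R z. z \<in> E \<Longrightarrow> 0 < r \<Longrightarrow> r \<le> R \<Longrightarrow> R < D1 \<Longrightarrow> R < 1 \<Longrightarrow>
        ennreal_of_enat (covering_number X r (ball z R \<inter> E)) \<le> ennreal (D2 * (R / r) powr d)"
    by simp
  define K where "K = min C2 (C2 / (D2 * 2 powr d))"
  have K: "0 < K" using C D by (simp add: K_def)
  have "ennreal (K * (R / r) powr \<beta>) \<le> ennreal_of_enat (covering_number X r (ball z R \<inter> E))"
    if z: "z \<in> E" and r: "0 < r" "r \<le> R powr (1 + \<Phi> R)"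
      and R: "R powr (1 + \<Phi> R) \<le> R" "R < Min {C1, D1 / 2, x0, 1 / 2}" "R < 1" for z r R
  proof -
    define s where "s = R powr (1 + \<Psi> R)"
    have R0: "0 < R" and rR: "r \<le> R" using r R by linarith+
    have s: "0 < s" "s \<le> R"
      using R0 R powr_one_plus_le_self[of R "\<Psi> R"] \<Psi> by (auto simp: s_def)
    let ?Y = "ball z R \<inter> E"
    show ?thesis
    proof (cases "r \<le> s")
      case True
      have "K * (R / r) powr \<beta> \<le> C2 * (R / r) powr \<alpha>"
        using \<alpha>0 C rR r by (intro mult_mono powr_mono) (auto simp: K_def)
      then have "ennreal (K * (R / r) powr \<beta>) \<le> ennreal (C2 * (R / r) powr \<alpha>)"
        by (rule ennreal_leI)
      also have "\<dots> \<le> ennreal_of_enat (covering_number X r ?Y)"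
        using bound[OF z r(1)] True s R by (simp add: s_def)
      finally show ?thesis .
    next
      case False
      have "R powr (1 + \<Phi> R) \<le> R powr (1 + lam * \<Psi> R)"
        using R R0 le[of R] by (intro powr_mono') auto
      then have r_le: "r \<le> R powr (1 + lam * \<Psi> R)" using r by linarith
      show ?thesis
      proof (cases "covering_number X r ?Y")
        case infinity
        then show ?thesis by simp
      next
        case (enat n)
        have "ennreal (C2 * (R / s) powr \<alpha>) \<le> ennreal_of_enat (covering_number X s ?Y)"
          using bound[OF z s(1)] s R by (simp add: s_def)
        also have "\<dots> \<le> ennreal (real n * (D2 * (2 * r / s) powr d))"
        proof (rule covering_number_submult[OF _ _ _ enat])
          show "ennreal_of_enat (covering_number X s (ball w (2 * r) \<inter> E))
                  \<le> ennreal (D2 * (2 * r / s) powr d)" if "w \<in> E" for w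
            using boundA[OF that s(1), of "2 * r"] False rR r R by auto
        qed (use D in auto)
        finally have "C2 * (R / s) powr \<alpha> \<le> real n * (D2 * (2 * r / s) powr d)"
          using D by (simp add: ennreal_le_iff)
        moreover have "C2 * ((R / r) powr \<beta> * (r / s) powr d) \<le> C2 * (R / s) powr \<alpha>"
          using powr_window_split[OF R0 _ r_le \<beta> d] False C by (simp add: s_def \<alpha>_def)
        moreover have "(2 * r / s) powr d = 2 powr d * (r / s) powr d"
          using powr_mult[of 2 "r / s" d] by simp
        ultimately have "C2 * (R / r) powr \<beta> * (r / s) powr d
            \<le> real n * (D2 * 2 powr d) * (r / s) powr d"
          by (simp only: mult.assoc)
        then have "C2 * (R / r) powr \<beta> \<le> real n * (D2 * 2 powr d)"
          using r s by (subst (asm) mult_le_cancel_right_pos) auto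
        then have "C2 / (D2 * 2 powr d) * (R / r) powr \<beta> \<le> real n"
          using D by (simp add: pos_divide_le_eq)
        moreover have "K * (R / r) powr \<beta> \<le> C2 / (D2 * 2 powr d) * (R / r) powr \<beta>"
          by (intro mult_right_mono) (auto simp: K_def)
        ultimately have "K * (R / r) powr \<beta> \<le> real n" by linarith
        then show ?thesis
          by (simp add: enat ennreal_of_nat_eq_real_of_nat ennreal_leI)
      qed
    qed
  qed
  then show ?thesis
    unfolding lower_exponent_set_def using C D lam K
    by (intro exI[of _ "Min {C1, D1 / 2, x0, 1 / 2}"] conjI exI[of _ K]) auto
qed

section \<open>Comparison of the dimensions\<close>

theorem proposition2p14:
  fixes \<Phi> \<Psi> :: "real \<Rightarrow> real" and lam x\<^sub>0 :: real
    and X E :: "'a::metric_space set" and \<mu> :: "'a measure"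
  assumes "dimension_function \<Phi>" and "dimension_function \<Psi>"
    and "0 < lam" and "lam < 1" and "0 < x\<^sub>0"
    and "\<And>x. 0 < x \<Longrightarrow> x \<le> x\<^sub>0 \<Longrightarrow> x < 1 \<Longrightarrow> \<Phi> x \<ge> lam * \<Psi> x"
    and "bounded X" and "E \<subseteq> X"
    and "borel_prob_on E \<mu>"
  shows "(upper_Phi_dim_measure \<Psi> \<mu> \<ge> ennreal lam * upper_Phi_dim_measure \<Phi> \<mu> \<and>
          lower_Phi_dim_measure \<Psi> \<mu>
            \<le> lower_Phi_dim_measure \<Phi> \<mu> + ennreal (1 - lam) * Assouad_dim_measure \<mu>) \<and>
         (upper_Phi_dim_set X \<Psi> E \<ge> ennreal lam * upper_Phi_dim_set X \<Phi> E \<and>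
          lower_Phi_dim_set X \<Psi> E
            \<le> lower_Phi_dim_set X \<Phi> E + ennreal (1 - lam) * Assouad_dim_set X E)"
proof -
  have \<Psi>: "0 \<le> \<Psi> x" if "0 < x" "x < 1" for x
    using assms(2) that by (auto simp: dimension_function_def)
  have lam: "0 < 1 - lam"
    using assms(4) by simp
  note defs = upper_Phi_dim_measure_def lower_Phi_dim_measure_def
    upper_Phi_dim_set_def lower_Phi_dim_set_def Assouad_dim_measure_def Assouad_dim_set_def
  note folds = upper_exponent_measure_def[symmetric] lower_exponent_measure_def[symmetric]
    upper_exponent_set_def[symmetric] lower_exponent_set_def[symmetric]
  show ?thesis
    unfolding defs folds
  proof (intro conjI)
    show "ennreal lam * Inf {ennreal \<alpha> |\<alpha>. 0 \<le> \<alpha> \<and> upper_exponent_measure \<Phi> \<mu> \<alpha>}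
        \<le> Inf {ennreal \<alpha> |\<alpha>. 0 \<le> \<alpha> \<and> upper_exponent_measure \<Psi> \<mu> \<alpha>}"
      using assms(3) by (rule mult_Inf_exponents_le)
        (rule upper_exponent_measure_transfer[OF assms(9) \<Psi> assms(3-6)])
    show "Sup {ennreal \<alpha> |\<alpha>. 0 \<le> \<alpha> \<and> lower_exponent_measure \<Psi> \<mu> \<alpha>}
        \<le> Sup {ennreal \<alpha> |\<alpha>. 0 \<le> \<alpha> \<and> lower_exponent_measure \<Phi> \<mu> \<alpha>}
          + ennreal (1 - lam) * Inf {ennreal \<alpha> |\<alpha>. 0 \<le> \<alpha> \<and> upper_exponent_measure (\<lambda>_. 0) \<mu> \<alpha>}"
      using lam by (rule Sup_exponents_le_add_mult_Inf)
        (rule lower_exponent_measure_transfer[OF assms(9) \<Psi> assms(4-6)])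
    show "ennreal lam * Inf {ennreal \<alpha> |\<alpha>. 0 \<le> \<alpha> \<and> upper_exponent_set X \<Phi> E \<alpha>}
        \<le> Inf {ennreal \<alpha> |\<alpha>. 0 \<le> \<alpha> \<and> upper_exponent_set X \<Psi> E \<alpha>}"
      using assms(3) by (rule mult_Inf_exponents_le)
        (rule upper_exponent_set_transfer[OF \<Psi> assms(3-6)])
    show "Sup {ennreal \<alpha> |\<alpha>. 0 \<le> \<alpha> \<and> lower_exponent_set X \<Psi> E \<alpha>}
        \<le> Sup {ennreal \<alpha> |\<alpha>. 0 \<le> \<alpha> \<and> lower_exponent_set X \<Phi> E \<alpha>}
          + ennreal (1 - lam) * Inf {ennreal \<alpha> |\<alpha>. 0 \<le> \<alpha> \<and> upper_exponent_set X (\<lambda>_. 0) E \<alpha>}"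
      using lam by (rule Sup_exponents_le_add_mult_Inf)
        (rule lower_exponent_set_transfer[OF \<Psi> assms(4-6)])
  qed
qed

end
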